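(* For $\Phi=A_{n-1}$ ($n\geq 3$), $B_n$ ($n\geq 2$), or $D_n$ ($n\geq 4$), the group of inner automorphisms of the Boolean reflection monoid satisfies $\mathrm{Inn}(M(\Phi,\mathcal B))\cong W(\Phi)/Z(W(\Phi))$, where $Z(W(\Phi))$ is the center of the Weyl group $W(\Phi)$.
   Context: Let $V=\mathbb R^n$ with standard orthonormal basis $v_1,\dots,v_n$, and let $W(\Phi)\subseteq GL(V)$ be the Weyl group: for $A_{n-1}$ the group of permutations of the basis; for $B_n$ the group of signed permutations of the basis; for $D_n$ the group of signed permutations with an even number of sign changes. For $J\subseteq\{1,\dots,n\}$ let $X(J)=\bigoplus_{j\in J}\mathbb R v_j$, and $\mathcal B=\{X(J): J\subseteq\{1,\dots,n\}\}$. For $g\in GL(V)$ and a subspace $Y$, $g_Y$ is the partial linear isomorphism given by restricting $g$ to $Y$; products are compositions of partial maps: $g_Yh_Z=(gh)_{Z\cap h^{-1}Y}$. The Boolean reflection monoid is $M(\Phi,\mathcal B)=\{g_X: g\in W(\Phi),X\in\mathcal B\}$; its group of units is $W(\Phi)$ (the elements $g_V$). An automorphism $\alpha$ of $M(\Phi,\mathcal B)$ is inner if there exists $g\in W(\Phi)$ with $\alpha(t)=gtg^{-1}$ for all $t\in M(\Phi,\mathcal B)$; $\mathrm{Inn}(M(\Phi,\mathcal B))$ is the group of inner automorphisms. *)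

theory Defs
  imports "HOL-Analysis.Analysis" "HOL-Algebra.Bij" "HOL-Algebra.Coset"
begin

text \<open>
  The space $V$ is \<^typ>\<open>real ^ 'n\<close> with $n$ = \<^term>\<open>CARD('n)\<close>, and its standard
  orthonormal basis consists of the vectors \<^term>\<open>axis i (1::real)\<close>.
\<close>

definition GL :: "(real ^ 'n \<Rightarrow> real ^ 'n) monoid" where
  "GL = \<lparr>carrier = {g. linear g \<and> bij g}, mult = (\<circ>), one = id\<rparr>"

definition signed_perm_by ::
    "('n \<Rightarrow> 'n) \<Rightarrow> ('n \<Rightarrow> real) \<Rightarrow> (real ^ 'n \<Rightarrow> real ^ 'n) \<Rightarrow> bool" where
  "signed_perm_by \<sigma> \<epsilon> g \<longleftrightarrow>
     bij \<sigma> \<and> (\<forall>i. \<epsilon> i \<in> {1, -1}) \<and> (\<forall>i. g (axis i 1) = \<epsilon> i *\<^sub>R axis (\<sigma> i) 1)"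

text \<open>
  The constructors stand for the families $A_{n-1}$, $B_n$, $D_n$; in all three cases the
  Weyl group acts on the $n$-dimensional space $V$ (so for type $A$ the rank is $n-1$).
\<close>

datatype weyl_type = TypeA | TypeB | TypeD

fun weyl :: "weyl_type \<Rightarrow> (real ^ 'n \<Rightarrow> real ^ 'n) set" where
  "weyl TypeA = {g \<in> carrier GL. \<exists>\<sigma>. bij \<sigma> \<and> (\<forall>i. g (axis i 1) = axis (\<sigma> i) 1)}"
| "weyl TypeB = {g \<in> carrier GL. \<exists>\<sigma> \<epsilon>. signed_perm_by \<sigma> \<epsilon> g}"
| "weyl TypeD = {g \<in> carrier GL. \<exists>\<sigma> \<epsilon>. signed_perm_by \<sigma> \<epsilon> g \<and> even (card {i. \<epsilon> i = -1})}"

definition weyl_group :: "weyl_type \<Rightarrow> (real ^ 'n \<Rightarrow> real ^ 'n) monoid" where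
  "weyl_group \<Phi> = GL\<lparr>carrier := weyl \<Phi>\<rparr>"

definition coord_subspace :: "'n set \<Rightarrow> (real ^ 'n) set" where
  "coord_subspace J = span ((\<lambda>j. axis j 1) ` J)"

definition boolean_system :: "(real ^ 'n) set set" where
  "boolean_system = range coord_subspace"

text \<open>
  \<open>partial_iso g Y\<close> is $g_Y$, a partial map undefined outside \<open>Y\<close>.  Partial maps compose
  by \<^const>\<open>map_comp\<close>, whose domain is the largest possible one; the lemma after the
  definition is the product formula $g_Y h_Z = (gh)_{Z \cap h^{-1} Y}$.
\<close>

definition partial_iso ::
    "(real ^ 'n \<Rightarrow> real ^ 'n) \<Rightarrow> (real ^ 'n) set \<Rightarrow> (real ^ 'n \<rightharpoonup> real ^ 'n)" where
  "partial_iso g Y = (Some \<circ> g) |` Y"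

lemma partial_iso_mult:
  "partial_iso g Y \<circ>\<^sub>m partial_iso h Z = partial_iso (g \<circ> h) (Z \<inter> h -` Y)"
  by (auto simp: partial_iso_def map_comp_def restrict_map_def fun_eq_iff)

definition boolean_reflection_monoid ::
    "weyl_type \<Rightarrow> (real ^ 'n \<rightharpoonup> real ^ 'n) monoid" where
  "boolean_reflection_monoid \<Phi> =
     \<lparr>carrier = {partial_iso g X | g X. g \<in> weyl \<Phi> \<and> X \<in> boolean_system},
      mult = (\<circ>\<^sub>m), one = partial_iso id UNIV\<rparr>"

text \<open>
  Automorphisms are the elements of \<^term>\<open>auto M\<close>: bijective multiplicative self-maps of the
  carrier, taken to be \<^const>\<open>undefined\<close> outside it.  An element $g$ of the Weyl group is
  identified with the unit $g_V$ of the monoid, and its inverse is taken in the monoid.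
\<close>

definition inner_auts ::
    "weyl_type \<Rightarrow> ((real ^ 'n \<rightharpoonup> real ^ 'n) \<Rightarrow> (real ^ 'n \<rightharpoonup> real ^ 'n)) set" where
  "inner_auts \<Phi> =
     (let M = boolean_reflection_monoid \<Phi> in
       {\<alpha> \<in> auto M. \<exists>g \<in> weyl \<Phi>. \<forall>t \<in> carrier M.
          \<alpha> t = partial_iso g UNIV \<otimes>\<^bsub>M\<^esub> t \<otimes>\<^bsub>M\<^esub> inv\<^bsub>M\<^esub> (partial_iso g UNIV)})"

definition Inn ::
    "weyl_type \<Rightarrow> ((real ^ 'n \<rightharpoonup> real ^ 'n) \<Rightarrow> (real ^ 'n \<rightharpoonup> real ^ 'n)) monoid" where
  "Inn \<Phi> = (AutoGroup (boolean_reflection_monoid \<Phi>))\<lparr>carrier := inner_auts \<Phi>\<rparr>"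

definition group_center :: "('a, 'b) monoid_scheme \<Rightarrow> 'a set" where
  "group_center G = {z \<in> carrier G. \<forall>x \<in> carrier G. z \<otimes>\<^bsub>G\<^esub> x = x \<otimes>\<^bsub>G\<^esub> z}"

end

theory Submission
  imports Defs
begin

text \<open>
  Conjugation by units is a homomorphism from the unit group of any monoid \<open>M\<close> to its
  automorphism group.  Composed with the embedding $g \mapsto g_V$ of $W(\Phi)$, it maps
  $W(\Phi)$ onto the inner automorphisms, so that by the first isomorphism theorem the only
  question is its kernel, the set of those $g$ for which $g_V$ commutes with all of
  $M(\Phi, \mathcal B)$.  Since $h \mapsto h_V$ is injective and multiplicative, such a $g$ is
  central in $W(\Phi)$.  Conversely
  $g_V h_X = (gh)_X$ and $h_X g_V = (hg)_{g^{-1} X}$, so a central $g$ lies in the kernel as soon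
  as it maps every coordinate subspace to itself
  (\<open>inner_automorphisms_iso_mod_center\<close> is the abstract form of this argument).

  This last condition is where the bounds on $n$ enter.  Every element of $W(\Phi)$ is a signed
  permutation, and it preserves all coordinate subspaces if and only if the underlying permutation
  \<open>\<sigma>\<close> is trivial.  If the element is central then \<open>\<sigma>\<close> commutes with every transposition, as
  the transpositions of basis vectors lie in all three Weyl groups; for $n \ge 3$ this forces
  \<open>\<sigma> = id\<close>.  In type $B$ the sign changes of single basis vectors also lie in the group, and
  commuting with these forces \<open>\<sigma> = id\<close> for $n = 2$ as well
  (\<open>weyl_central_perm_id\<close>).
\<close>

section \<open>Conjugation by units of a monoid\<close>

definition conj_by :: "('a, 'b) monoid_scheme \<Rightarrow> 'a \<Rightarrow> 'a \<Rightarrow> 'a" where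
  "conj_by M u = (\<lambda>t\<in>carrier M. u \<otimes>\<^bsub>M\<^esub> t \<otimes>\<^bsub>M\<^esub> inv\<^bsub>M\<^esub> u)"

context monoid
begin

lemma inv_mult_Units:
  assumes "u \<in> Units G" "v \<in> Units G"
  shows "inv (u \<otimes> v) = inv v \<otimes> inv u"
proof (rule inv_unique'[symmetric])
  have cl: "u \<in> carrier G" "v \<in> carrier G" "inv u \<in> carrier G" "inv v \<in> carrier G"
    using assms by auto
  have "(u \<otimes> v) \<otimes> (inv v \<otimes> inv u) = u \<otimes> (v \<otimes> inv v) \<otimes> inv u"
    using cl by (simp only: m_assoc m_closed)
  then show "(u \<otimes> v) \<otimes> (inv v \<otimes> inv u) = \<one>" using assms cl by simp
  have "(inv v \<otimes> inv u) \<otimes> (u \<otimes> v) = inv v \<otimes> (inv u \<otimes> u) \<otimes> v"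
    using cl by (simp only: m_assoc m_closed)
  then show "(inv v \<otimes> inv u) \<otimes> (u \<otimes> v) = \<one>" using assms cl by simp
qed (use assms in auto)

lemma conj_by_mult:
  assumes "u \<in> Units G" "v \<in> Units G"
  shows "conj_by G (u \<otimes> v) = compose (carrier G) (conj_by G u) (conj_by G v)"
  using assms by (auto simp: conj_by_def compose_def inv_mult_Units m_assoc Units_closed)

lemma conj_by_one: "conj_by G \<one> = (\<lambda>t\<in>carrier G. t)"
  by (auto simp: conj_by_def)

lemma conj_by_Bij:
  assumes "u \<in> Units G"
  shows "conj_by G u \<in> Bij (carrier G)"
proof -
  have cancel: "conj_by G v (conj_by G w t) = t"
    if "v \<in> Units G" "w \<in> Units G" "v \<otimes> w = \<one>" "t \<in> carrier G" for v w t
    using conj_by_mult[of v w] that by (simp add: conj_by_one compose_def fun_eq_iff) metis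
  have "bij_betw (conj_by G u) (carrier G) (carrier G)"
    by (rule bij_betw_byWitness[where f' = "conj_by G (inv u)"])
      (use assms in \<open>auto simp: cancel\<close>, auto simp: conj_by_def)
  then show ?thesis by (simp add: Bij_def conj_by_def)
qed

lemma conj_by_auto:
  assumes "u \<in> Units G"
  shows "conj_by G u \<in> auto G"
proof -
  have "u \<otimes> (s \<otimes> t) \<otimes> inv u = (u \<otimes> s \<otimes> inv u) \<otimes> (u \<otimes> t \<otimes> inv u)"
    if "s \<in> carrier G" "t \<in> carrier G" for s t
  proof -
    have cl: "u \<in> carrier G" "inv u \<in> carrier G" using assms by auto
    have "(u \<otimes> s \<otimes> inv u) \<otimes> (u \<otimes> t \<otimes> inv u) = u \<otimes> s \<otimes> (inv u \<otimes> u) \<otimes> t \<otimes> inv u"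
      using that cl by (simp only: m_assoc m_closed)
    then show ?thesis using that cl assms by (simp add: m_assoc)
  qed
  moreover have "u \<otimes> t \<otimes> inv u \<in> carrier G" if "t \<in> carrier G" for t
    using assms that by auto
  ultimately show ?thesis
    using conj_by_Bij[OF assms] by (auto simp: auto_def hom_def conj_by_def)
qed

lemma conj_by_trivial_iff:
  assumes "u \<in> Units G"
  shows "conj_by G u = (\<lambda>t\<in>carrier G. t) \<longleftrightarrow> (\<forall>t\<in>carrier G. u \<otimes> t = t \<otimes> u)"
proof -
  have cl: "u \<in> carrier G" "inv u \<in> carrier G" using assms by auto
  have "u \<otimes> t \<otimes> inv u = t \<longleftrightarrow> u \<otimes> t = t \<otimes> u" if "t \<in> carrier G" for t
  proof
    assume "u \<otimes> t \<otimes> inv u = t"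
    then have "t \<otimes> u = u \<otimes> t \<otimes> inv u \<otimes> u" by simp
    then show "u \<otimes> t = t \<otimes> u" using that cl assms by (simp add: m_assoc)
  next
    assume "u \<otimes> t = t \<otimes> u"
    then show "u \<otimes> t \<otimes> inv u = t" using that cl assms by (simp add: m_assoc)
  qed
  then show ?thesis by (auto simp: conj_by_def fun_eq_iff)
qed

text \<open>
  A group \<open>W\<close> embedded by \<open>f\<close> as units of the monoid acts on it by conjugation.  The kernel
  always lies inside the center of \<open>W\<close>, by injectivity of \<open>f\<close>; the hypothesis on central
  elements is the reverse inclusion, and the claim is then the first isomorphism theorem.
\<close>

lemma inner_automorphisms_iso_mod_center:
  fixes W (structure)
  assumes W: "group W"
    and units: "f \<in> carrier W \<rightarrow> Units G"
    and mult: "\<And>x y. \<lbrakk>x \<in> carrier W; y \<in> carrier W\<rbrakk> \<Longrightarrow> f (x \<otimes>\<^bsub>W\<^esub> y) = f x \<otimes>\<^bsub>G\<^esub> f y"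
    and inj: "inj_on f (carrier W)"
    and one: "f \<one>\<^bsub>W\<^esub> = \<one>\<^bsub>G\<^esub>"
    and central: "\<And>z t. \<lbrakk>z \<in> group_center W; t \<in> carrier G\<rbrakk> \<Longrightarrow> f z \<otimes>\<^bsub>G\<^esub> t = t \<otimes>\<^bsub>G\<^esub> f z"
  shows "(AutoGroup G)\<lparr>carrier := (\<lambda>w. conj_by G (f w)) ` carrier W\<rparr> \<cong> W Mod group_center W"
proof -
  interpret W: group W by (rule W)
  let ?B = "BijGroup (carrier G)"
  let ?c = "\<lambda>w. conj_by G (f w)"
  let ?I = "(AutoGroup G)\<lparr>carrier := ?c ` carrier W\<rparr>"
  have fU: "f w \<in> Units G" if "w \<in> carrier W" for w
    using units that by auto
  have "?c \<in> hom W ?B"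
    using conj_by_Bij[OF fU] by (auto simp: hom_def BijGroup_def mult conj_by_mult fU)
  moreover have I_eq: "?I = ?B\<lparr>carrier := ?c ` carrier W, one := ?c \<one>\<^bsub>W\<^esub>\<rparr>"
    by (simp add: AutoGroup_def BijGroup_def one conj_by_one)
  ultimately have I: "group ?I" and hom: "?c \<in> hom W ?I"
    using W.hom_imp_img_group[of ?c ?B] by (auto simp: hom_def)
  have trivial_iff: "?c w = \<one>\<^bsub>?I\<^esub> \<longleftrightarrow> (\<forall>t\<in>carrier G. f w \<otimes>\<^bsub>G\<^esub> t = t \<otimes>\<^bsub>G\<^esub> f w)"
    if "w \<in> carrier W" for w
    using conj_by_trivial_iff[OF fU[OF that]] by (simp add: AutoGroup_def BijGroup_def)
  have ker: "kernel W ?I ?c = group_center W"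
  proof (intro equalityI subsetI)
    fix w assume "w \<in> kernel W ?I ?c"
    then have w: "w \<in> carrier W" and comm: "\<And>t. t \<in> carrier G \<Longrightarrow> f w \<otimes>\<^bsub>G\<^esub> t = t \<otimes>\<^bsub>G\<^esub> f w"
      using trivial_iff unfolding kernel_def by blast+
    have "f (w \<otimes>\<^bsub>W\<^esub> x) = f (x \<otimes>\<^bsub>W\<^esub> w)" if "x \<in> carrier W" for x
      using that comm w fU[OF that] by (simp add: mult Units_closed)
    then show "w \<in> group_center W"
      using w by (auto simp: group_center_def intro: inj_onD[OF inj])
  next
    fix w assume w: "w \<in> group_center W"
    then have "w \<in> carrier W" by (simp add: group_center_def)
    moreover from this have "?c w = \<one>\<^bsub>?I\<^esub>"
      using trivial_iff central[OF w] by simp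
    ultimately show "w \<in> kernel W ?I ?c" by (simp add: kernel_def)
  qed
  interpret hom: group_hom W ?I ?c
    by (intro group_hom.intro group_hom_axioms.intro W I hom)
  have "W Mod group_center W \<cong> ?I"
    using hom.FactGroup_iso unfolding ker by simp
  then show ?thesis
    using group.iso_sym[OF hom.normal_kernel[THEN normal.factorgroup_is_group]] ker by simp
qed

end

section \<open>Signed permutations of the standard basis\<close>

text \<open>
  A coordinate description of the linear map $v_i \mapsto \varepsilon_i v_{\sigma(i)}$; it has
  the intended meaning only for a bijective \<open>\<sigma>\<close>.
\<close>

definition signed_perm :: "('n \<Rightarrow> 'n) \<Rightarrow> ('n \<Rightarrow> real) \<Rightarrow> real ^ 'n \<Rightarrow> real ^ 'n" where
  "signed_perm \<sigma> \<epsilon> x = (\<chi> j. \<epsilon> (inv_into UNIV \<sigma> j) * x $ inv_into UNIV \<sigma> j)"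

lemma signed_perm_nth:
  "bij \<sigma> \<Longrightarrow> signed_perm \<sigma> \<epsilon> x $ \<sigma> i = \<epsilon> i * x $ i"
  by (simp add: signed_perm_def bij_is_inj)

lemma signed_perm_eqI:
  assumes "bij \<sigma>" "\<And>i. y $ \<sigma> i = \<epsilon> i * x $ i"
  shows "signed_perm \<sigma> \<epsilon> x = y"
proof -
  have "signed_perm \<sigma> \<epsilon> x $ j = y $ j" for j
    using assms signed_perm_nth[of \<sigma> \<epsilon> x "inv_into UNIV \<sigma> j"] by (metis bij_inv_eq_iff)
  then show ?thesis by (simp add: vec_eq_iff)
qed

lemma signed_perm_axis:
  "bij \<sigma> \<Longrightarrow> signed_perm \<sigma> \<epsilon> (axis i 1) = \<epsilon> i *\<^sub>R axis (\<sigma> i) 1"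
  by (rule signed_perm_eqI) (auto simp: axis_def bij_is_inj inj_eq)

lemma signed_perm_eqD:
  assumes "signed_perm \<sigma> \<epsilon> = signed_perm \<tau> \<delta>" "bij \<sigma>" "bij \<tau>" "\<epsilon> i \<noteq> 0"
  shows "\<sigma> i = \<tau> i" "\<epsilon> i = \<delta> i"
proof -
  have "(\<epsilon> i *\<^sub>R axis (\<sigma> i) 1 :: real ^ 'a) $ \<sigma> i = (\<delta> i *\<^sub>R axis (\<tau> i) 1 :: real ^ 'a) $ \<sigma> i"
    using assms by (metis signed_perm_axis)
  then show "\<sigma> i = \<tau> i" "\<epsilon> i = \<delta> i"
    using assms by (auto simp: axis_def split: if_splits)
qed

lemma signed_perm_comp:
  assumes "bij \<sigma>" "bij \<tau>"
  shows "signed_perm \<sigma> \<epsilon> \<circ> signed_perm \<tau> \<delta> = signed_perm (\<sigma> \<circ> \<tau>) (\<lambda>i. \<epsilon> (\<tau> i) * \<delta> i)"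
proof
  fix x
  show "(signed_perm \<sigma> \<epsilon> \<circ> signed_perm \<tau> \<delta>) x = signed_perm (\<sigma> \<circ> \<tau>) (\<lambda>i. \<epsilon> (\<tau> i) * \<delta> i) x"
    by (rule sym, rule signed_perm_eqI) (use assms in \<open>simp_all add: bij_comp signed_perm_nth\<close>)
qed

lemma signed_perm_id: "signed_perm id (\<lambda>_. 1) = id"
  by (auto simp: signed_perm_def vec_eq_iff)

lemma linear_signed_perm: "linear (signed_perm \<sigma> \<epsilon>)"
  by (rule linearI) (simp_all add: signed_perm_def vec_eq_iff algebra_simps)

lemma linear_eq_signed_perm:
  fixes g :: "real ^ 'n::finite \<Rightarrow> real ^ 'n"
  assumes "linear g" "bij \<sigma>" "\<And>i. g (axis i 1) = \<epsilon> i *\<^sub>R axis (\<sigma> i) 1"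
  shows "g = signed_perm \<sigma> \<epsilon>"
proof (rule linear_eq_stdbasis[OF assms(1) linear_signed_perm])
  fix b :: "real ^ 'n"
  assume "b \<in> Basis"
  then obtain i where "b = axis i 1" by (auto simp: Basis_vec_def)
  then show "g b = signed_perm \<sigma> \<epsilon> b" using assms by (simp add: signed_perm_axis)
qed

section \<open>The Weyl groups\<close>

text \<open>
  The uniform description of the three Weyl groups.  For type $D$, an even number of sign
  changes is expressed by a product, which is visibly multiplicative.
\<close>

definition weyl_data :: "weyl_type \<Rightarrow> ('n::finite \<Rightarrow> 'n) \<Rightarrow> ('n \<Rightarrow> real) \<Rightarrow> bool" where
  "weyl_data \<Phi> \<sigma> \<epsilon> \<longleftrightarrow> bij \<sigma> \<and> (\<forall>i. \<epsilon> i \<in> {1, -1}) \<and>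
     (\<Phi> = TypeA \<longrightarrow> (\<forall>i. \<epsilon> i = 1)) \<and> (\<Phi> = TypeD \<longrightarrow> prod \<epsilon> UNIV = 1)"

lemma prod_signs:
  fixes \<epsilon> :: "'n::finite \<Rightarrow> real"
  assumes "\<forall>i. \<epsilon> i \<in> {1, -1}"
  shows "prod \<epsilon> UNIV = (-1) ^ card {i. \<epsilon> i = -1}"
proof -
  have "prod \<epsilon> UNIV = (\<Prod>i\<in>UNIV. if \<epsilon> i = -1 then -1 else 1)"
    using assms by (intro prod.cong) auto
  also have "\<dots> = (\<Prod>i\<in>{i. \<epsilon> i = -1}. -1)"
    by (subst prod.If_cases) auto
  finally show ?thesis by simp
qed

lemma weyl_data_comp:
  assumes "weyl_data \<Phi> \<sigma> \<epsilon>" "weyl_data \<Phi> \<tau> \<delta>"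
  shows "weyl_data \<Phi> (\<sigma> \<circ> \<tau>) (\<lambda>i. \<epsilon> (\<tau> i) * \<delta> i)"
proof -
  have bij: "bij \<sigma>" "bij \<tau>" using assms by (auto simp: weyl_data_def)
  have "(\<Prod>i\<in>UNIV. \<epsilon> (\<tau> i) * \<delta> i) = prod \<epsilon> UNIV * prod \<delta> UNIV"
    using prod.reindex_bij_betw[of \<tau> UNIV UNIV \<epsilon>] bij by (simp add: prod.distrib)
  moreover have "\<epsilon> (\<tau> i) * \<delta> i \<in> {1, -1}" for i
  proof -
    have "\<epsilon> (\<tau> i) \<in> {1, -1}" "\<delta> i \<in> {1, -1}" using assms unfolding weyl_data_def by blast+
    then show ?thesis by auto
  qed
  ultimately show ?thesis
    using assms bij by (simp add: weyl_data_def bij_comp)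
qed

lemma weyl_data_inverse:
  assumes "weyl_data \<Phi> \<sigma> \<epsilon>"
  shows "weyl_data \<Phi> (inv_into UNIV \<sigma>) (\<lambda>i. \<epsilon> (inv_into UNIV \<sigma> i))"
proof -
  have "bij \<sigma>" using assms by (simp add: weyl_data_def)
  then have "bij (inv_into UNIV \<sigma>)" by (rule bij_imp_bij_inv)
  moreover from this have "(\<Prod>i\<in>UNIV. \<epsilon> (inv_into UNIV \<sigma> i)) = prod \<epsilon> UNIV"
    by (rule prod.reindex_bij_betw)
  ultimately show ?thesis using assms by (simp add: weyl_data_def)
qed

lemma signed_perm_inverse:
  assumes "weyl_data \<Phi> \<sigma> \<epsilon>"
  shows "signed_perm \<sigma> \<epsilon> \<circ> signed_perm (inv_into UNIV \<sigma>) (\<lambda>i. \<epsilon> (inv_into UNIV \<sigma> i)) = id"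
    and "signed_perm (inv_into UNIV \<sigma>) (\<lambda>i. \<epsilon> (inv_into UNIV \<sigma> i)) \<circ> signed_perm \<sigma> \<epsilon> = id"
proof -
  have bij: "bij \<sigma>" "bij (inv_into UNIV \<sigma>)"
    using assms by (auto simp: weyl_data_def bij_imp_bij_inv)
  have "\<epsilon> i \<in> {1, -1}" for i
    using assms unfolding weyl_data_def by blast
  then have sq: "\<epsilon> i * \<epsilon> i = 1" for i
    by (metis insert_iff mult_1 mult_minus1 minus_minus singletonD)
  show "signed_perm \<sigma> \<epsilon> \<circ> signed_perm (inv_into UNIV \<sigma>) (\<lambda>i. \<epsilon> (inv_into UNIV \<sigma> i)) = id"
    using bij by (simp add: signed_perm_comp sq signed_perm_id bij_is_surj surj_iff[THEN iffD1])
  show "signed_perm (inv_into UNIV \<sigma>) (\<lambda>i. \<epsilon> (inv_into UNIV \<sigma> i)) \<circ> signed_perm \<sigma> \<epsilon> = id"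
    using bij by (simp add: signed_perm_comp sq signed_perm_id bij_is_inj)
qed

lemma weyl_iff:
  fixes g :: "real ^ 'n::finite \<Rightarrow> real ^ 'n"
  shows "g \<in> weyl \<Phi> \<longleftrightarrow> (\<exists>\<sigma> \<epsilon>. weyl_data \<Phi> \<sigma> \<epsilon> \<and> g = signed_perm \<sigma> \<epsilon>)"
proof
  assume g: "g \<in> weyl \<Phi>"
  then have lin: "linear g" by (cases \<Phi>) (auto simp: GL_def)
  have "\<exists>\<sigma> \<epsilon>. weyl_data \<Phi> \<sigma> \<epsilon> \<and> (\<forall>i. g (axis i 1) = \<epsilon> i *\<^sub>R axis (\<sigma> i) 1)"
  proof (cases \<Phi>)
    case TypeA
    then obtain \<sigma> where "bij \<sigma>" "\<forall>i. g (axis i 1) = axis (\<sigma> i) 1" using g by auto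
    then show ?thesis
      using TypeA by (intro exI[of _ \<sigma>] exI[of _ "\<lambda>_. 1"]) (simp add: weyl_data_def)
  next
    case TypeB
    then show ?thesis using g by (auto simp: weyl_data_def signed_perm_by_def)
  next
    case TypeD
    then obtain \<sigma> \<epsilon> where "signed_perm_by \<sigma> \<epsilon> g" "even (card {i. \<epsilon> i = -1})" using g by auto
    then show ?thesis
      using TypeD by (intro exI[of _ \<sigma>] exI[of _ \<epsilon>])
        (simp add: weyl_data_def signed_perm_by_def prod_signs)
  qed
  then show "\<exists>\<sigma> \<epsilon>. weyl_data \<Phi> \<sigma> \<epsilon> \<and> g = signed_perm \<sigma> \<epsilon>"
    using linear_eq_signed_perm[OF lin] by (metis weyl_data_def)
next
  assume "\<exists>\<sigma> \<epsilon>. weyl_data \<Phi> \<sigma> \<epsilon> \<and> g = signed_perm \<sigma> \<epsilon>"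
  then obtain \<sigma> \<epsilon> where d: "weyl_data \<Phi> \<sigma> \<epsilon>" and g: "g = signed_perm \<sigma> \<epsilon>" by blast
  have "bij g"
    using signed_perm_inverse[OF d] unfolding g by (intro o_bij)
  then have GL: "g \<in> carrier GL"
    by (simp add: GL_def g linear_signed_perm)
  have ax: "\<forall>i. g (axis i 1) = \<epsilon> i *\<^sub>R axis (\<sigma> i) 1"
    using d by (simp add: g signed_perm_axis weyl_data_def)
  show "g \<in> weyl \<Phi>"
  proof (cases \<Phi>)
    case TypeA
    then show ?thesis using GL ax d by (auto simp: weyl_data_def)
  next
    case TypeB
    then show ?thesis using GL ax d by (auto simp: weyl_data_def signed_perm_by_def)
  next
    case TypeD
    have "(-1 :: real) ^ card {i. \<epsilon> i = -1} = 1"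
      using d TypeD prod_signs[of \<epsilon>] by (simp add: weyl_data_def)
    then have "even (card {i. \<epsilon> i = -1})"
      by (metis one_neq_neg_one uminus_power_if power_one)
    then show ?thesis using TypeD GL ax d by (auto simp: weyl_data_def signed_perm_by_def)
  qed
qed

lemma weylE:
  assumes "g \<in> weyl \<Phi>"
  obtains \<sigma> \<epsilon> where "weyl_data \<Phi> \<sigma> \<epsilon>" "g = signed_perm \<sigma> \<epsilon>"
  using assms by (auto simp: weyl_iff)

lemma weyl_id: "id \<in> weyl \<Phi>"
proof -
  have "weyl_data \<Phi> id (\<lambda>_. 1)" by (simp add: weyl_data_def)
  then show ?thesis using signed_perm_id by (metis weyl_iff)
qed

lemma weyl_comp:
  assumes "g \<in> weyl \<Phi>" "h \<in> weyl \<Phi>"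
  shows "g \<circ> h \<in> weyl \<Phi>"
proof -
  obtain \<sigma> \<epsilon> \<tau> \<delta> where "weyl_data \<Phi> \<sigma> \<epsilon>" "g = signed_perm \<sigma> \<epsilon>"
    "weyl_data \<Phi> \<tau> \<delta>" "h = signed_perm \<tau> \<delta>"
    using assms by (auto elim!: weylE)
  moreover from this have "bij \<sigma>" "bij \<tau>" by (auto simp: weyl_data_def)
  ultimately show ?thesis
    using weyl_data_comp[of \<Phi> \<sigma> \<epsilon> \<tau> \<delta>] signed_perm_comp unfolding weyl_iff by metis
qed

lemma weyl_inverse:
  assumes "g \<in> weyl \<Phi>"
  obtains h where "h \<in> weyl \<Phi>" "g \<circ> h = id" "h \<circ> g = id"
proof -
  obtain \<sigma> \<epsilon> where d: "weyl_data \<Phi> \<sigma> \<epsilon>" and g: "g = signed_perm \<sigma> \<epsilon>"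
    using assms by (rule weylE)
  show thesis
    using that signed_perm_inverse[OF d] weyl_data_inverse[OF d] unfolding g weyl_iff by blast
qed

lemma group_weyl_group: "group (weyl_group \<Phi>)"
proof (rule groupI)
  fix g assume "g \<in> carrier (weyl_group \<Phi>)"
  then have "g \<in> weyl \<Phi>" by (simp add: weyl_group_def)
  then show "\<exists>h\<in>carrier (weyl_group \<Phi>). h \<otimes>\<^bsub>weyl_group \<Phi>\<^esub> g = \<one>\<^bsub>weyl_group \<Phi>\<^esub>"
    by (rule weyl_inverse) (auto simp: weyl_group_def GL_def)
qed (auto simp: weyl_group_def GL_def weyl_comp weyl_id comp_assoc)

text \<open>
  If $n \ge 3$, a permutation commuting with all transpositions is trivial: were
  $\sigma(i) = k \ne i$, then for $j \notin \{i, k\}$ commuting with $(i\,j)$ would give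
  $\sigma(j) = k$ as well.  In type $B$, commuting with the sign change of $v_i$ shows that
  $v_{\sigma(i)}$ is an eigenvector of it for the eigenvalue $-1$, so $\sigma(i) = i$.
\<close>

lemma weyl_central_perm_id:
  fixes \<sigma> :: "'n::finite \<Rightarrow> 'n"
  assumes n: "\<Phi> = TypeB \<or> CARD('n) \<ge> 3"
    and d: "weyl_data \<Phi> \<sigma> \<epsilon>"
    and comm: "\<And>h. h \<in> weyl \<Phi> \<Longrightarrow> signed_perm \<sigma> \<epsilon> \<circ> h = h \<circ> signed_perm \<sigma> \<epsilon>"
  shows "\<sigma> = id"
proof (rule ccontr)
  have bij: "bij \<sigma>" and "\<epsilon> i \<in> {1, -1}" for i
    using d unfolding weyl_data_def by blast+
  then have nz: "\<epsilon> i \<noteq> 0" for i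
    by (metis insert_iff singletonD zero_neq_one zero_neq_neg_one)
  assume "\<sigma> \<noteq> id"
  then obtain i where i: "\<sigma> i \<noteq> i" by (auto simp: fun_eq_iff)
  show False
  proof (cases "\<Phi> = TypeB")
    case True
    define \<delta> :: "'n \<Rightarrow> real" where "\<delta> = (\<lambda>j. if j = i then -1 else 1)"
    have "weyl_data \<Phi> id \<delta>" using True by (simp add: weyl_data_def \<delta>_def)
    then have "signed_perm \<sigma> \<epsilon> \<circ> signed_perm id \<delta> = signed_perm id \<delta> \<circ> signed_perm \<sigma> \<epsilon>"
      using comm weyl_iff by blast
    then have "signed_perm \<sigma> (\<lambda>j. \<epsilon> j * \<delta> j) = signed_perm \<sigma> (\<lambda>j. \<delta> (\<sigma> j) * \<epsilon> j)"
      using bij by (simp add: signed_perm_comp)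
    then have "\<epsilon> i * \<delta> i = \<delta> (\<sigma> i) * \<epsilon> i"
      by (rule signed_perm_eqD(2)) (use bij nz in \<open>auto simp: \<delta>_def\<close>)
    then show False using i nz[of i] by (simp add: \<delta>_def)
  next
    case False
    have "\<exists>j. j \<notin> {i, \<sigma> i}"
    proof (rule ccontr)
      assume "\<not> ?thesis"
      then have "(UNIV :: 'n set) = {i, \<sigma> i}" by auto
      then have "CARD('n) = card {i, \<sigma> i}" by simp
      also have "\<dots> = 2" using i by simp
      finally show False using n False by simp
    qed
    then obtain j where j: "j \<noteq> i" "j \<noteq> \<sigma> i" by auto
    define \<tau> where "\<tau> = id(i := j, j := i)"
    have "\<tau> \<circ> \<tau> = id" by (auto simp: \<tau>_def fun_eq_iff)
    then have bt: "bij \<tau>" by (intro o_bij)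
    then have "weyl_data \<Phi> \<tau> (\<lambda>_. 1)" by (simp add: weyl_data_def)
    then have "signed_perm \<sigma> \<epsilon> \<circ> signed_perm \<tau> (\<lambda>_. 1) = signed_perm \<tau> (\<lambda>_. 1) \<circ> signed_perm \<sigma> \<epsilon>"
      using comm weyl_iff by blast
    then have "signed_perm (\<sigma> \<circ> \<tau>) (\<lambda>k. \<epsilon> (\<tau> k)) = signed_perm (\<tau> \<circ> \<sigma>) \<epsilon>"
      using bij bt by (simp add: signed_perm_comp)
    then have "(\<sigma> \<circ> \<tau>) i = (\<tau> \<circ> \<sigma>) i"
      by (rule signed_perm_eqD(1)) (use bij bt nz in \<open>auto intro: bij_comp\<close>)
    then have "\<sigma> (\<tau> i) = \<tau> (\<sigma> i)" by simp
    then have "\<sigma> j = \<sigma> i" using i j by (simp add: \<tau>_def)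
    then show False using bij j by (simp add: bij_is_inj inj_eq)
  qed
qed

section \<open>The Boolean reflection monoid\<close>

lemma coord_subspace_eq:
  fixes J :: "'n::finite set"
  shows "coord_subspace J = {x. \<forall>i. i \<notin> J \<longrightarrow> x $ i = 0}"
proof
  show "coord_subspace J \<subseteq> {x. \<forall>i. i \<notin> J \<longrightarrow> x $ i = 0}"
    unfolding coord_subspace_def
    by (rule span_minimal) (auto simp: axis_def subspace_def)
  show "{x. \<forall>i. i \<notin> J \<longrightarrow> x $ i = 0} \<subseteq> coord_subspace J"
  proof
    fix x :: "real ^ 'n"
    assume x: "x \<in> {x. \<forall>i. i \<notin> J \<longrightarrow> x $ i = 0}"
    have "x = (\<Sum>j\<in>UNIV. x $ j *\<^sub>R axis j 1)"
      using basis_expansion[of x] by (simp add: scalar_mult_eq_scaleR)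
    also have "\<dots> = (\<Sum>j\<in>J. x $ j *\<^sub>R axis j 1)"
      by (rule sum.mono_neutral_right) (use x in auto)
    also have "\<dots> \<in> coord_subspace J"
      unfolding coord_subspace_def by (intro span_sum span_scale span_base) auto
    finally show "x \<in> coord_subspace J" .
  qed
qed

lemma vimage_coord_subspace:
  assumes "weyl_data \<Phi> \<sigma> \<epsilon>"
  shows "signed_perm \<sigma> \<epsilon> -` coord_subspace J = coord_subspace (\<sigma> -` J)"
proof -
  have bij: "bij \<sigma>" and "\<epsilon> i \<in> {1, -1}" for i
    using assms unfolding weyl_data_def by blast+
  then have nz: "\<epsilon> i \<noteq> 0" for i
    by (metis insert_iff singletonD zero_neq_one zero_neq_neg_one)
  have all: "(\<forall>j. P j) \<longleftrightarrow> (\<forall>i. P (\<sigma> i))" for P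
    using bij by (metis bij_pointE)
  show ?thesis
    by (subst (1 2) coord_subspace_eq) (subst all, auto simp: signed_perm_nth[OF bij] nz)
qed

lemma boolean_system_vimage:
  assumes "g \<in> weyl \<Phi>" "X \<in> boolean_system"
  shows "g -` X \<in> boolean_system"
  using assms vimage_coord_subspace by (force simp: boolean_system_def elim!: weylE)

lemma boolean_system_Int:
  fixes X :: "(real ^ 'n::finite) set"
  assumes "X \<in> boolean_system" "Y \<in> boolean_system"
  shows "X \<inter> Y \<in> boolean_system"
proof -
  have "coord_subspace I \<inter> coord_subspace J = coord_subspace (I \<inter> J)" for I J :: "'n set"
    by (auto simp: coord_subspace_eq)
  then show ?thesis using assms by (auto simp: boolean_system_def)
qed

lemma UNIV_boolean_system: "(UNIV :: (real ^ 'n::finite) set) \<in> boolean_system"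
proof -
  have "(UNIV :: (real ^ 'n) set) = coord_subspace UNIV" by (simp add: coord_subspace_eq)
  then show ?thesis unfolding boolean_system_def by blast
qed

lemma partial_iso_in_monoid:
  "g \<in> weyl \<Phi> \<Longrightarrow> X \<in> boolean_system \<Longrightarrow> partial_iso g X \<in> carrier (boolean_reflection_monoid \<Phi>)"
  by (auto simp: boolean_reflection_monoid_def)

lemma monoid_boolean_reflection_monoid:
  "monoid (boolean_reflection_monoid \<Phi> :: (real ^ 'n::finite \<rightharpoonup> real ^ 'n) monoid)"
proof (rule monoidI)
  let ?M = "boolean_reflection_monoid \<Phi> :: (real ^ 'n \<rightharpoonup> real ^ 'n) monoid"
  show "s \<otimes>\<^bsub>?M\<^esub> t \<in> carrier ?M" if st: "s \<in> carrier ?M" "t \<in> carrier ?M" for s t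
  proof -
    obtain g h X Y where "s = partial_iso g X" "t = partial_iso h Y"
      "g \<in> weyl \<Phi>" "h \<in> weyl \<Phi>" "X \<in> boolean_system" "Y \<in> boolean_system"
      using st by (auto simp: boolean_reflection_monoid_def)
    then have "s \<otimes>\<^bsub>?M\<^esub> t = partial_iso (g \<circ> h) (Y \<inter> h -` X)"
      "partial_iso (g \<circ> h) (Y \<inter> h -` X) \<in> carrier ?M"
      by (auto simp: boolean_reflection_monoid_def partial_iso_mult
          intro!: partial_iso_in_monoid weyl_comp boolean_system_Int boolean_system_vimage)
    then show ?thesis by simp
  qed
  show "\<one>\<^bsub>?M\<^esub> \<in> carrier ?M"
    using partial_iso_in_monoid[OF weyl_id UNIV_boolean_system]
    by (simp add: boolean_reflection_monoid_def)
  show "(s \<otimes>\<^bsub>?M\<^esub> t) \<otimes>\<^bsub>?M\<^esub> u = s \<otimes>\<^bsub>?M\<^esub> (t \<otimes>\<^bsub>?M\<^esub> u)" for s t u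
    by (auto simp: boolean_reflection_monoid_def map_comp_def fun_eq_iff split: option.splits)
  show "\<one>\<^bsub>?M\<^esub> \<otimes>\<^bsub>?M\<^esub> t = t" for t
    by (auto simp: boolean_reflection_monoid_def partial_iso_def map_comp_def fun_eq_iff
        split: option.splits)
  show "t \<otimes>\<^bsub>?M\<^esub> \<one>\<^bsub>?M\<^esub> = t" for t
    by (auto simp: boolean_reflection_monoid_def partial_iso_def map_comp_def fun_eq_iff
        split: option.splits)
qed

lemma partial_iso_UNIV_mult:
  "partial_iso g UNIV \<otimes>\<^bsub>boolean_reflection_monoid \<Phi>\<^esub> partial_iso h UNIV = partial_iso (g \<circ> h) UNIV"
  by (simp add: boolean_reflection_monoid_def partial_iso_mult)

lemma partial_iso_UNIV_Units:
  fixes g :: "real ^ 'n::finite \<Rightarrow> real ^ 'n"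
  assumes g: "g \<in> weyl \<Phi>"
  shows "partial_iso g UNIV \<in> Units (boolean_reflection_monoid \<Phi>)"
proof -
  let ?M = "boolean_reflection_monoid \<Phi> :: (real ^ 'n \<rightharpoonup> real ^ 'n) monoid"
  obtain h where "h \<in> weyl \<Phi>" "g \<circ> h = id" "h \<circ> g = id" using g by (rule weyl_inverse)
  moreover have "\<one>\<^bsub>?M\<^esub> = partial_iso id UNIV" by (simp add: boolean_reflection_monoid_def)
  ultimately show ?thesis
    using partial_iso_in_monoid[OF g UNIV_boolean_system]
      partial_iso_in_monoid[of h \<Phi>, OF _ UNIV_boolean_system]
    by (auto simp: Units_def partial_iso_UNIV_mult intro!: bexI[of _ "partial_iso h UNIV"])
qed

text \<open>
  Here $g_V h_X = (gh)_X$ and $h_X g_V = (hg)_{g^{-1} X}$ agree because $gh = hg$ and because a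
  central \<open>g\<close> only changes the signs of basis vectors, so that $g^{-1} X = X$.
\<close>

lemma weyl_center_commutes:
  fixes g :: "real ^ 'n::finite \<Rightarrow> real ^ 'n"
  assumes n: "\<Phi> = TypeB \<or> CARD('n) \<ge> 3"
    and g: "g \<in> group_center (weyl_group \<Phi>)"
    and t: "t \<in> carrier (boolean_reflection_monoid \<Phi>)"
  shows "partial_iso g UNIV \<otimes>\<^bsub>boolean_reflection_monoid \<Phi>\<^esub> t =
         t \<otimes>\<^bsub>boolean_reflection_monoid \<Phi>\<^esub> partial_iso g UNIV"
proof -
  have gW: "g \<in> weyl \<Phi>" and comm: "\<And>h. h \<in> weyl \<Phi> \<Longrightarrow> g \<circ> h = h \<circ> g"
    using g by (auto simp: group_center_def weyl_group_def GL_def)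
  obtain \<sigma> \<epsilon> where d: "weyl_data \<Phi> \<sigma> \<epsilon>" and g_eq: "g = signed_perm \<sigma> \<epsilon>"
    using gW by (rule weylE)
  have "\<sigma> = id"
    using weyl_central_perm_id[OF n d] comm unfolding g_eq by blast
  then have "g -` coord_subspace J = coord_subspace J" for J
    using vimage_coord_subspace[OF d] by (simp add: g_eq)
  moreover obtain h J where "h \<in> weyl \<Phi>" "t = partial_iso h (coord_subspace J)"
    using t by (auto simp: boolean_reflection_monoid_def boolean_system_def)
  ultimately show ?thesis
    using comm by (simp add: boolean_reflection_monoid_def partial_iso_mult)
qed

lemma inner_auts_eq_image:
  fixes \<Phi> :: weyl_type
  defines "M \<equiv> boolean_reflection_monoid \<Phi> :: (real ^ 'n::finite \<rightharpoonup> real ^ 'n) monoid"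
  shows "inner_auts \<Phi> = (\<lambda>g. conj_by M (partial_iso g UNIV)) ` weyl \<Phi>"
proof -
  interpret monoid M
    unfolding M_def by (rule monoid_boolean_reflection_monoid)
  have eq_conj: "\<alpha> = conj_by M (partial_iso g UNIV)"
    if "\<alpha> \<in> auto M"
      and "\<forall>t\<in>carrier M. \<alpha> t = partial_iso g UNIV \<otimes>\<^bsub>M\<^esub> t \<otimes>\<^bsub>M\<^esub> inv\<^bsub>M\<^esub> (partial_iso g UNIV)" for \<alpha> g
  proof (rule extensionalityI[where A = "carrier M"])
    show "\<alpha> \<in> extensional (carrier M)"
      using that by (simp add: auto_def Bij_imp_extensional)
  qed (use that in \<open>simp_all add: conj_by_def\<close>)
  have conj_auto: "conj_by M (partial_iso g UNIV) \<in> auto M" if "g \<in> weyl \<Phi>" for g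
    using conj_by_auto partial_iso_UNIV_Units[OF that] by (simp add: M_def)
  show ?thesis
  proof (intro equalityI subsetI)
    fix \<alpha> :: "(real ^ 'n \<rightharpoonup> real ^ 'n) \<Rightarrow> (real ^ 'n \<rightharpoonup> real ^ 'n)"
    assume "\<alpha> \<in> inner_auts \<Phi>"
    then show "\<alpha> \<in> (\<lambda>g. conj_by M (partial_iso g UNIV)) ` weyl \<Phi>"
      unfolding inner_auts_def Let_def M_def[symmetric] using eq_conj by blast
  next
    fix \<alpha> assume "\<alpha> \<in> (\<lambda>g. conj_by M (partial_iso g UNIV)) ` weyl \<Phi>"
    then obtain g where g: "g \<in> weyl \<Phi>" and \<alpha>: "\<alpha> = conj_by M (partial_iso g UNIV)" by blast
    have "\<forall>t\<in>carrier M.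
        \<alpha> t = partial_iso g UNIV \<otimes>\<^bsub>M\<^esub> t \<otimes>\<^bsub>M\<^esub> inv\<^bsub>M\<^esub> (partial_iso g UNIV)"
      by (simp add: \<alpha> conj_by_def)
    then show "\<alpha> \<in> inner_auts \<Phi>"
      unfolding inner_auts_def Let_def M_def[symmetric] using g conj_auto[OF g] \<alpha> by blast
  qed
qed

theorem theorem4p10:
  fixes \<Phi> :: weyl_type
  assumes "(\<Phi> = TypeA \<and> CARD('n::finite) \<ge> 3) \<or>
           (\<Phi> = TypeB \<and> CARD('n) \<ge> 2) \<or>
           (\<Phi> = TypeD \<and> CARD('n) \<ge> 4)"
  shows "(Inn \<Phi> :: ((real ^ 'n \<rightharpoonup> real ^ 'n) \<Rightarrow> (real ^ 'n \<rightharpoonup> real ^ 'n)) monoid) \<cong>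
         ((weyl_group \<Phi> :: (real ^ 'n \<Rightarrow> real ^ 'n) monoid) Mod
           group_center (weyl_group \<Phi> :: (real ^ 'n \<Rightarrow> real ^ 'n) monoid))"
proof -
  define M where "M = (boolean_reflection_monoid \<Phi> :: (real ^ 'n \<rightharpoonup> real ^ 'n) monoid)"
  define W where "W = (weyl_group \<Phi> :: (real ^ 'n \<Rightarrow> real ^ 'n) monoid)"
  define f where "f = (\<lambda>g :: real ^ 'n \<Rightarrow> real ^ 'n. partial_iso g UNIV)"
  have n: "\<Phi> = TypeB \<or> CARD('n) \<ge> 3" using assms by auto
  have W_simps: "carrier W = weyl \<Phi>" "mult W = (\<circ>)" "one W = id"
    by (simp_all add: W_def weyl_group_def GL_def)
  interpret monoid M
    unfolding M_def by (rule monoid_boolean_reflection_monoid)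
  have "(AutoGroup M)\<lparr>carrier := (\<lambda>w. conj_by M (f w)) ` carrier W\<rparr> \<cong> W Mod group_center W"
  proof (rule inner_automorphisms_iso_mod_center)
    show "group W" unfolding W_def by (rule group_weyl_group)
    show "f \<in> carrier W \<rightarrow> Units M"
      by (auto simp: W_simps f_def M_def partial_iso_UNIV_Units)
    show "f (x \<otimes>\<^bsub>W\<^esub> y) = f x \<otimes>\<^bsub>M\<^esub> f y" for x y
      by (simp add: W_simps f_def M_def partial_iso_UNIV_mult)
    show "inj_on f (carrier W)"
      by (auto simp: inj_on_def f_def partial_iso_def fun_eq_iff)
    show "f \<one>\<^bsub>W\<^esub> = \<one>\<^bsub>M\<^esub>"
      by (simp add: W_simps f_def M_def boolean_reflection_monoid_def)
    show "f z \<otimes>\<^bsub>M\<^esub> t = t \<otimes>\<^bsub>M\<^esub> f z" if "z \<in> group_center W" "t \<in> carrier M" for z t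
      using weyl_center_commutes[OF n] that by (simp add: f_def M_def W_def)
  qed
  then show ?thesis
    by (simp add: Inn_def inner_auts_eq_image M_def W_def f_def weyl_group_def)
qed

end
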